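(* Let $p\geq1$ and $q,l\geq0$ be integers with $l\geq q$. Then for every integer $m\geq1$, \[ \sum_{n=1}^{\infty}\frac{H_n^{(p,q)}}{(n+m)\binom{n+m+l}{l}} =\sum_{j=0}^{l-q}\binom{l-q}{j}\left\{\frac{(-1)^{j+p-1}H_{m+j}}{(m+j)^{p}}+\sum_{k=1}^{p-1}\frac{(-1)^{j+k-1}}{(m+j)^{k}}\zeta(p+1-k)\right\}, \] and \[ \sum_{n=1}^{\infty}\frac{H_n^{(p,q)}}{n\binom{n+l}{l}} =\zeta(p+1)-\sum_{j=1}^{l-q}\binom{l-q}{j}\left\{\frac{(-1)^{j+p}H_{j}}{j^{p}}+\sum_{k=1}^{p-1}\frac{(-1)^{j+k}}{j^{k}}\zeta(p+1-k)\right\}. \]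
   Context: $\zeta$ is the Riemann zeta function and $H_n=\sum_{j=1}^{n}1/j$ is the $n$th harmonic number. The generalized hyperharmonic numbers are defined for $p\in\mathbb{Z}$, $n\geq1$ by $H_n^{(p,0)}=1/n^{p}$ and $H_n^{(p,r)}=\sum_{k=1}^{n}H_k^{(p,r-1)}$ for $r\geq1$. Empty sums are zero. *)

theory Defs
  imports "HOL-Analysis.Harmonic_Numbers"
begin

(* The Riemann zeta function on the half-line s > 1, where it is given by its Dirichlet
   series; the value is only meaningful there. *)
definition zeta :: "real \<Rightarrow> real" where
  "zeta s = (\<Sum>n. 1 / real (Suc n) powr s)"

(* "hyperharmonic p r n" is the generalized hyperharmonic number with lower index n and
   upper index (p, r), for n >= 1. *)
fun hyperharmonic :: "int \<Rightarrow> nat \<Rightarrow> nat \<Rightarrow> real" where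
  "hyperharmonic p 0 n = 1 / real n powi p"
| "hyperharmonic p (Suc r) n = (\<Sum>k=1..n. hyperharmonic p r k)"

end

theory Submission
  imports Defs "HOL-Analysis.Uniform_Limit"
begin

text \<open>
  Put \<open>w l x = 1 / (x * binomial (x + l) l)\<close>.  Since \<open>w (l + 1) x = w l x - w l (x + 1)\<close> and
  \<open>w l x\<close> tends to 0, summation by parts lowers \<open>q\<close> and \<open>l\<close> simultaneously, which reduces
  everything to \<open>q = 0\<close>.  There the partial fraction expansion of \<open>w l\<close> leaves
  the series of \<open>1 / (n ^ p * (n + m))\<close>, and these are evaluated by recursion on \<open>p\<close>.
\<close>

section \<open>Inverse binomial weights\<close>

text \<open>For \<open>x\<close> at least 1 this is the Beta value B(x, l+1), the integral of
  t^(x-1) (1-t)^l over [0,1]; at \<open>x = 0\<close> division by zero makes it 0.\<close>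

definition binomial_weight :: "nat \<Rightarrow> nat \<Rightarrow> real" where
  "binomial_weight l x = 1 / (real x * real ((x + l) choose l))"

lemma binomial_weight_0 [simp]: "binomial_weight 0 x = 1 / real x"
  by (simp add: binomial_weight_def)

lemma binomial_weight_nonneg: "binomial_weight l x \<ge> 0"
  by (simp add: binomial_weight_def)

text \<open>Under the Beta integral this is (1-t)^(l+1) = (1-t)^l - t (1-t)^l. The proof is
  algebraic: both larger binomial coefficients are rational multiples of \<open>A\<close>.\<close>

lemma binomial_weight_Suc:
  assumes "x \<ge> 1"
  shows "binomial_weight (Suc l) x = binomial_weight l x - binomial_weight l (Suc x)"
proof -
  define A where "A = real ((x + l) choose l)"
  have A: "A > 0" by (simp add: A_def)
  have 1: "real (Suc l) * real ((x + Suc l) choose Suc l) = real (Suc (x + l)) * A"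
    using Suc_times_binomial_eq[of "x + l" l] unfolding A_def
    by (metis add_Suc_right mult.commute of_nat_mult)
  have 2: "real (Suc x) * real ((Suc x + l) choose l) = real (Suc (x + l)) * A"
    using binomial_absorb_comp[of "Suc (x + l)" l] unfolding A_def
    by (metis Suc_diff_le add_Suc add_diff_cancel_right' diff_Suc_1 le_add2 of_nat_mult)
  have 3: "real ((x + Suc l) choose Suc l) = real (Suc (x + l)) * A / real (Suc l)"
    using 1 by (simp add: field_simps del: of_nat_Suc binomial_Suc_Suc)
  have "binomial_weight l x - binomial_weight l (Suc x)
        = 1 / (real x * A) - 1 / (real (Suc (x + l)) * A)"
    unfolding binomial_weight_def 2 A_def ..
  also have "\<dots> = (real (Suc (x + l)) - real x) / (real x * (real (Suc (x + l)) * A))"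
    using A assms by (simp add: divide_simps del: of_nat_Suc)
  also have "real (Suc (x + l)) - real x = real (Suc l)" by simp
  also have "real (Suc l) / (real x * (real (Suc (x + l)) * A)) = binomial_weight (Suc l) x"
    unfolding binomial_weight_def 3 by simp
  finally show ?thesis ..
qed

text \<open>By the recursion, each unit step of the argument lowers the weight by a weight of index
  \<open>Suc l\<close>, which is nonnegative. The bound on \<open>x\<close> excludes the value 0
  taken at \<open>x = 0\<close>.\<close>

lemma binomial_weight_decseq:
  assumes "x \<ge> 1" "x \<le> y"
  shows "binomial_weight l y \<le> binomial_weight l x"
  using assms(2)
proof (induction y rule: dec_induct)
  case (step n)
  then show ?case
    using binomial_weight_Suc[of n l] binomial_weight_nonneg[of "Suc l" n] assms(1) by simp
qed simp

lemma binomial_weight_le: "binomial_weight l x \<le> 1 / real x"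
proof (cases "x = 0")
  case False
  have "real x \<le> real x * real ((x + l) choose l)"
    using False by (simp add: Suc_leI)
  then show ?thesis
    using False by (auto simp: binomial_weight_def intro!: divide_left_mono)
qed (simp add: binomial_weight_def)

lemma binomial_weight_tendsto_0: "(\<lambda>n. binomial_weight l (n + m)) \<longlonglongrightarrow> 0"
proof -
  have "binomial_weight l \<longlonglongrightarrow> 0"
    by (rule tendsto_sandwich[OF _ _ tendsto_const lim_1_over_n])
      (auto simp: binomial_weight_nonneg binomial_weight_le)
  then show ?thesis by (rule LIMSEQ_ignore_initial_segment)
qed

text \<open>Iterating the recursion exhibits the weight as an \<open>l\<close>-fold alternating
  difference of 1/x.\<close>

lemma binomial_weight_partial_fractions:
  assumes "x \<ge> 1"
  shows "binomial_weight l x = (\<Sum>j=0..l. (-1) ^ j * real (l choose j) / real (x + j))"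
  using assms
proof (induction l arbitrary: x)
  case (Suc l)
  let ?t = "\<lambda>l x j. (-1) ^ j * real (l choose j) / real (x + j)"
  have "(\<Sum>j=0..Suc l. ?t (Suc l) x j) = ?t (Suc l) x 0 + (\<Sum>j=0..l. ?t (Suc l) x (Suc j))"
    by (simp only: sum.atLeast0_atMost_Suc_shift o_def)
  \<comment> \<open>Pascal's rule splits the coefficient; the half with \<open>l choose j\<close>
    changes sign and reads \<open>x + Suc j\<close> as \<open>Suc x + j\<close>.\<close>
  also have "(\<Sum>j=0..l. ?t (Suc l) x (Suc j)) = (\<Sum>j=0..l. ?t l x (Suc j)) - (\<Sum>j=0..l. ?t l (Suc x) j)"
    unfolding sum_subtractf[symmetric]
    by (intro sum.cong) (simp_all add: add_divide_distrib diff_divide_distrib algebra_simps)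
  also have "?t (Suc l) x 0 + ((\<Sum>j=0..l. ?t l x (Suc j)) - (\<Sum>j=0..l. ?t l (Suc x) j))
             = (\<Sum>j=0..Suc l. ?t l x j) - (\<Sum>j=0..l. ?t l (Suc x) j)"
    by (simp only: sum.atLeast0_atMost_Suc_shift o_def) simp
  also have "(\<Sum>j=0..Suc l. ?t l x j) = (\<Sum>j=0..l. ?t l x j)"
    by (simp add: binomial_eq_0)
  also have "(\<Sum>j=0..l. ?t l x j) = binomial_weight l x"
    by (rule Suc.IH[OF Suc.prems, symmetric])
  also have "(\<Sum>j=0..l. ?t l (Suc x) j) = binomial_weight l (Suc x)"
    by (rule Suc.IH[symmetric]) simp
  also have "binomial_weight l x - binomial_weight l (Suc x) = binomial_weight (Suc l) x"
    by (rule binomial_weight_Suc[OF Suc.prems, symmetric])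
  finally show ?case ..
qed simp

section \<open>Summation by parts for series\<close>

text \<open>
  The boundary term \<open>(\<Sum>k<n. f k) * b n\<close> vanishes by dominated convergence, the terms
  \<open>f k * b n\<close> with \<open>k < n\<close> being dominated by \<open>f k * b k\<close>.
\<close>

lemma sums_partial_summation:
  fixes f b :: "nat \<Rightarrow> real"
  assumes f: "\<And>n. f n \<ge> 0" and b: "\<And>n. b n \<ge> 0" "decseq b" "b \<longlonglongrightarrow> 0"
    and S: "(\<lambda>n. f n * b n) sums S"
  shows "(\<lambda>n. (\<Sum>k\<le>n. f k) * (b n - b (Suc n))) sums S"
proof -
  let ?g = "\<lambda>k n. if k < n then f k * b n else 0"
  have "(\<lambda>n. \<Sum>k. ?g k n) \<longlonglongrightarrow> (\<Sum>k. 0)"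
  proof (rule tannerys_theorem[THEN conjunct2, THEN conjunct2])
    show "(?g k \<longlongrightarrow> 0) sequentially" for k
    proof (rule Lim_transform_eventually)
      show "(\<lambda>n. f k * b n) \<longlonglongrightarrow> 0"
        using tendsto_mult_right_zero[OF b(3)] .
      show "\<forall>\<^sub>F n in sequentially. f k * b n = ?g k n"
        using eventually_gt_at_top[of k] by eventually_elim simp
    qed
    show "\<forall>\<^sub>F (k, n) in at_top \<times>\<^sub>F sequentially. norm (?g k n) \<le> f k * b k"
    proof (intro always_eventually allI)
      fix z :: "nat \<times> nat"
      obtain k n where z: "z = (k, n)" by (cases z)
      have "norm (?g k n) \<le> f k * b k"
        using f[of k] b(1)[of n] b(1)[of k] mult_left_mono[OF decseqD[OF b(2), of k n] f[of k]]
        by (cases "k < n") (simp_all add: abs_of_nonneg)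
      then show "case z of (k, n) \<Rightarrow> norm (?g k n) \<le> f k * b k"
        by (simp only: z prod.case)
    qed
    show "summable (\<lambda>k. f k * b k)"
      using S by (simp add: sums_iff)
  qed simp
  moreover have "(\<Sum>k. ?g k n) = (\<Sum>k<n. f k) * b n" for n
    by (subst suminf_finite[of "{..<n}"]) (auto simp: sum_distrib_right)
  ultimately have boundary: "(\<lambda>n. (\<Sum>k<n. f k) * b n) \<longlonglongrightarrow> 0"
    by simp
  \<comment> \<open>Finite Abel summation: the two partial sums differ by the boundary term alone,
    so they share the limit \<open>S\<close>.\<close>
  have "(\<Sum>n<N. (\<Sum>k\<le>n. f k) * (b n - b (Suc n))) = (\<Sum>n<N. f n * b n) - (\<Sum>k<N. f k) * b N" for N
    by (induction N) (simp_all add: algebra_simps lessThan_Suc_atMost[symmetric])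
  then show ?thesis
    using tendsto_diff[OF S[unfolded sums_def] boundary] by (simp add: sums_def)
qed

section \<open>Raising the order of the hyperharmonic numbers\<close>

lemma hyperharmonic_nonneg: "hyperharmonic (int p) q n \<ge> 0"
  by (induction q arbitrary: n) (auto intro: sum_nonneg)

text \<open>Summation by parts turns the numbers of order \<open>q\<close> into their partial sums,
  of order \<open>Suc q\<close>, and the weights into their differences, of index
  \<open>Suc l\<close>. The value \<open>S\<close> is unchanged.\<close>

lemma hyperharmonic_Suc_sums:
  assumes "(\<lambda>n. hyperharmonic (int p) q (Suc n) * binomial_weight l (Suc n + m)) sums S"
  shows "(\<lambda>n. hyperharmonic (int p) (Suc q) (Suc n) * binomial_weight (Suc l) (Suc n + m)) sums S"
proof -
  have "(\<lambda>n. binomial_weight l (Suc n + m)) \<longlonglongrightarrow> 0"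
    using binomial_weight_tendsto_0[of l "Suc m"] by simp
  moreover have "decseq (\<lambda>n. binomial_weight l (Suc n + m))"
    by (intro decseq_SucI binomial_weight_decseq) auto
  ultimately have "(\<lambda>n. (\<Sum>k\<le>n. hyperharmonic (int p) q (Suc k))
      * (binomial_weight l (Suc n + m) - binomial_weight l (Suc (Suc n) + m))) sums S"
    using assms by (intro sums_partial_summation) (auto simp: hyperharmonic_nonneg binomial_weight_nonneg)
  moreover have "(\<Sum>k\<le>n. hyperharmonic (int p) q (Suc k)) = hyperharmonic (int p) (Suc q) (Suc n)" for n
    by (simp add: sum.atLeast1_atMost_eq lessThan_Suc_atMost del: sum.lessThan_Suc sum.cl_ivl_Suc)
  moreover have "binomial_weight l (Suc n + m) - binomial_weight l (Suc (Suc n) + m)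
      = binomial_weight (Suc l) (Suc n + m)" for n
    by (simp add: binomial_weight_Suc)
  ultimately show ?thesis by (simp only:)
qed

text \<open>Since \<open>S\<close> survives every step, the final value depends only on the
  difference of the weight index and the order; this is the source of \<open>l - q\<close> in the
  result.\<close>

lemma hyperharmonic_sums:
  assumes "(\<lambda>n. 1 / real (Suc n) ^ p * binomial_weight l (Suc n + m)) sums S"
  shows "(\<lambda>n. hyperharmonic (int p) q (Suc n) * binomial_weight (l + q) (Suc n + m)) sums S"
proof (induction q)
  case 0
  show ?case
    using assms by (simp only: hyperharmonic.simps power_int_of_nat add_0_right)
next
  case (Suc q)
  from hyperharmonic_Suc_sums[OF Suc] show ?case
    by (simp only: add_Suc_right)
qed

section \<open>Evaluation of the linear series\<close>

lemma zeta_sums: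
  assumes "p \<ge> 2"
  shows "(\<lambda>n. 1 / real (Suc n) ^ p) sums zeta (real p)"
proof -
  have "summable (\<lambda>n. 1 / real (Suc n) ^ p)"
    using inverse_power_summable[OF assms, where ?'a = real]
    unfolding inverse_eq_divide by (subst summable_Suc_iff)
  moreover have "1 / real (Suc n) powr real p = 1 / real (Suc n) ^ p" for n
    by (simp add: powr_realpow del: of_nat_Suc)
  ultimately show ?thesis
    by (simp add: zeta_def sums_iff del: of_nat_Suc)
qed

text \<open>The two harmonic series diverge separately, so the shift grows one unit at a time: each
  unit adds a telescoping series with sum \<open>1 / real (Suc m)\<close>.\<close>

lemma sums_harm: "(\<lambda>n. 1 / real (Suc n) - 1 / real (Suc n + m)) sums harm m"
proof (induction m)
  case (Suc m)
  have "(\<lambda>n. 1 / real (n + Suc m)) \<longlonglongrightarrow> 0"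
    by (rule LIMSEQ_ignore_initial_segment[OF lim_1_over_n])
  from telescope_sums'[OF this]
  have "(\<lambda>n. 1 / real (n + Suc m) - 1 / real (Suc n + Suc m)) sums (1 / real (Suc m))"
    by simp
  from sums_add[OF Suc this] show ?case
    by (simp only: harm_Suc inverse_eq_divide add_Suc add_Suc_right diff_add_cancel add_diff_eq)
qed (simp add: harm_expand)

text \<open>Write A_s for the sum of 1 / (n^s (n+m)). Then A_1 = H_m / m and A_(s+1) = (zeta(s+1) -
  A_s) / m; the statement unrolls this for s = \<open>Suc p\<close>.\<close>

lemma linear_zeta_sums:
  assumes "m \<ge> 1"
  shows "(\<lambda>n. 1 / real (Suc n) ^ Suc p / real (Suc n + m)) sums
     ((-1) ^ p * harm m / real m ^ Suc p
      + (\<Sum>k=1..p. (-1) ^ (k - 1) / real m ^ k * zeta (real (Suc p) + 1 - real k)))"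
proof -
  \<comment> \<open>Used with \<open>a\<close> = n, and with \<open>b\<close> = 1 in the base case
    and \<open>b\<close> = n^(p+1) in the induction step.\<close>
  have partial_fractions: "1 / (a * b) / (a + real m) = (1 / (a * b) - 1 / b / (a + real m)) / real m"
    if "a > 0" "b > 0" for a b :: real
  proof -
    have "a \<noteq> 0" "b \<noteq> 0" "real m \<noteq> 0" "a + real m \<noteq> 0"
      using assms that by auto
    then show ?thesis by (simp add: divide_simps; simp add: algebra_simps)
  qed
  show ?thesis
  proof (induction p)
    case 0
    have "1 / real (Suc n) ^ Suc 0 / real (Suc n + m) = (1 / real (Suc n) - 1 / real (Suc n + m)) / real m" for n
      using partial_fractions[of "real (Suc n)" 1] by (simp add: add_ac)
    with sums_divide[OF sums_harm[of m], of "real m"] show ?case by simp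
  next
    case (Suc p)
    let ?E = "\<lambda>p. (-1) ^ p * harm m / real m ^ Suc p
        + (\<Sum>k=1..p. (-1) ^ (k - 1) / real m ^ k * zeta (real (Suc p) + 1 - real k))"
    have "1 / real (Suc n) ^ Suc (Suc p) / real (Suc n + m)
        = (1 / real (Suc n) ^ Suc (Suc p) - 1 / real (Suc n) ^ Suc p / real (Suc n + m)) / real m" for n
      using partial_fractions[of "real (Suc n)" "real (Suc n) ^ Suc p"]
      by (simp add: add_ac)
    moreover have "(zeta (real (Suc (Suc p))) - ?E p) / real m = ?E (Suc p)"
    proof -
      \<comment> \<open>The summand \<open>k = 1\<close> is the zeta value newly introduced by the
        recursion; the others are the old summands, shifted by one, negated and divided by
        \<open>m\<close>.\<close>
      have "(\<Sum>k=1..Suc p. (-1) ^ (k - 1) / real m ^ k * zeta (real (Suc (Suc p)) + 1 - real k))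
          = zeta (real (Suc (Suc p))) / real m
            + (\<Sum>k=1..p. (-1) ^ k / real m ^ Suc k * zeta (real (Suc p) + 1 - real k))"
        by (subst sum.atLeast_Suc_atMost) (simp_all add: sum.shift_bounds_cl_Suc_ivl add_diff_eq del: sum.cl_ivl_Suc)
      also have "(\<Sum>k=1..p. (-1) ^ k / real m ^ Suc k * zeta (real (Suc p) + 1 - real k))
          = - (\<Sum>k=1..p. (-1) ^ (k - 1) / real m ^ k * zeta (real (Suc p) + 1 - real k)) / real m"
        unfolding sum_negf[symmetric] sum_divide_distrib
      proof (rule sum.cong)
        fix k assume "k \<in> {1..p}"
        then obtain i where "k = Suc i" by (cases k) auto
        then show "(-1) ^ k / real m ^ Suc k * zeta (real (Suc p) + 1 - real k)
          = - ((-1) ^ (k - 1) / real m ^ k * zeta (real (Suc p) + 1 - real k)) / real m"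
          by simp
      qed simp
      finally show ?thesis
        by (simp add: add_divide_distrib diff_divide_distrib mult.commute)
    qed
    ultimately show ?case
      using sums_divide[OF sums_diff[OF zeta_sums[of "Suc (Suc p)"] Suc.IH], of "real m"] by simp
  qed
qed

section \<open>Hyperharmonic series with inverse binomial coefficients\<close>

theorem theorem3:
  fixes p q l :: nat
  assumes "p \<ge> 1" and "l \<ge> q"
  shows "(\<forall>m::nat. m \<ge> 1 \<longrightarrow>
      (\<lambda>n. hyperharmonic (int p) q (Suc n)
             / (real (Suc n + m) * real ((Suc n + m + l) choose l)))
      sums (\<Sum>j=0..l-q. real ((l - q) choose j) *
              ((-1) ^ (j + p - 1) * harm (m + j) / real (m + j) ^ p
               + (\<Sum>k=1..p-1. (-1) ^ (j + k - 1) / real (m + j) ^ k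
                               * zeta (real p + 1 - real k)))))
    \<and> (\<lambda>n. hyperharmonic (int p) q (Suc n)
             / (real (Suc n) * real ((Suc n + l) choose l)))
      sums (zeta (real p + 1)
            - (\<Sum>j=1..l-q. real ((l - q) choose j) *
                 ((-1) ^ (j + p) * harm j / real j ^ p
                  + (\<Sum>k=1..p-1. (-1) ^ (j + k) / real j ^ k
                                  * zeta (real p + 1 - real k)))))"
proof -
  define L where "L = l - q"
  have l: "l = L + q" using assms by (simp add: L_def)
  obtain r where p: "p = Suc r" using assms by (cases p) auto
  define E where "E m = (-1) ^ r * harm m / real m ^ p
      + (\<Sum>k=1..r. (-1) ^ (k - 1) / real m ^ k * zeta (real p + 1 - real k))" for m
  have E: "(\<lambda>n. 1 / real (Suc n) ^ p / real (Suc n + m)) sums E m" if "m \<ge> 1" for m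
    unfolding E_def p using linear_zeta_sums[OF that, of r] .
  \<comment> \<open>Shared by both claims: \<open>m = 0\<close> is allowed, and the values
    \<open>e j\<close> of the shifted linear series stay abstract because \<open>j = 0\<close> is
    exceptional there. The finite sum over \<open>j\<close> comes from the partial fractions of the
    weight of index \<open>L\<close>.\<close>
  have reduce: "(\<lambda>n. hyperharmonic (int p) q (Suc n)
        / (real (Suc n + m) * real ((Suc n + m + l) choose l)))
      sums (\<Sum>j=0..L. (-1) ^ j * real (L choose j) * e j)"
    if "\<And>j. (\<lambda>n. 1 / real (Suc n) ^ p / real (Suc n + m + j)) sums e j" for m e
  proof -
    have "(\<lambda>n. \<Sum>j=0..L. (-1) ^ j * real (L choose j) * (1 / real (Suc n) ^ p / real (Suc n + m + j)))
      sums (\<Sum>j=0..L. (-1) ^ j * real (L choose j) * e j)"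
      by (intro sums_sum sums_mult that)
    moreover have "(\<Sum>j=0..L. (-1) ^ j * real (L choose j) * (1 / real (Suc n) ^ p / real (Suc n + m + j)))
        = 1 / real (Suc n) ^ p * binomial_weight L (Suc n + m)" for n
      by (simp add: binomial_weight_partial_fractions sum_distrib_left divide_simps mult_ac)
    ultimately have "(\<lambda>n. 1 / real (Suc n) ^ p * binomial_weight L (Suc n + m))
        sums (\<Sum>j=0..L. (-1) ^ j * real (L choose j) * e j)"
      by simp
    from hyperharmonic_sums[OF this, of q] show ?thesis
      unfolding binomial_weight_def l by simp
  qed
  show ?thesis
    unfolding L_def[symmetric]
  proof (intro conjI allI impI)
    fix m :: nat assume m: "m \<ge> 1"
    \<comment> \<open>The truncated subtractions in the exponents are harmless, as \<open>p\<close>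
      and every \<open>k\<close> in the range are at least 1.\<close>
    have "(-1) ^ j * E (m + j) = (-1) ^ (j + p - 1) * harm (m + j) / real (m + j) ^ p
               + (\<Sum>k=1..p-1. (-1) ^ (j + k - 1) / real (m + j) ^ k * zeta (real p + 1 - real k))" for j
      unfolding E_def distrib_left sum_distrib_left
      by (intro arg_cong2[of _ _ _ _ "(+)"] sum.cong) (auto simp: p power_add[symmetric] mult.assoc[symmetric])
    then have eq: "(-1) ^ j * real (L choose j) * E (m + j) = real (L choose j) *
              ((-1) ^ (j + p - 1) * harm (m + j) / real (m + j) ^ p
               + (\<Sum>k=1..p-1. (-1) ^ (j + k - 1) / real (m + j) ^ k
                               * zeta (real p + 1 - real k)))" for j
      by (metis mult.assoc mult.commute)
    have "(\<lambda>n. 1 / real (Suc n) ^ p / real (Suc n + m + j)) sums E (m + j)" for j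
      using E[of "m + j"] m by (simp add: add.assoc)
    from reduce[OF this] show "(\<lambda>n. hyperharmonic (int p) q (Suc n)
             / (real (Suc n + m) * real ((Suc n + m + l) choose l)))
      sums (\<Sum>j=0..L. real (L choose j) *
              ((-1) ^ (j + p - 1) * harm (m + j) / real (m + j) ^ p
               + (\<Sum>k=1..p-1. (-1) ^ (j + k - 1) / real (m + j) ^ k
                               * zeta (real p + 1 - real k))))"
      unfolding eq .
  next
    \<comment> \<open>With zero shift the series is that of 1 / n^(p+1), whereas \<open>E 0\<close>
      is 0 through division by zero.\<close>
    define e where "e j = (if j = 0 then zeta (real p + 1) else E j)" for j
    have "(\<lambda>n. 1 / real (Suc n) ^ p / real (Suc n + 0 + j)) sums e j" for j
    proof (cases "j = 0")
      case True
      then show ?thesis using zeta_sums[of "Suc p"] p by (simp add: e_def mult.commute add.commute)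
    next
      case False
      then show ?thesis using E[of j] by (simp add: e_def)
    qed
    note sums = reduce[OF this]
    \<comment> \<open>The exponents \<open>j + p\<close> and \<open>j + k\<close> exceed those of
      the first claim by one, which accounts for the minus sign in front of the sum.\<close>
    have "- ((-1) ^ j * E j) = (-1) ^ (j + p) * harm j / real j ^ p
               + (\<Sum>k=1..p-1. (-1) ^ (j + k) / real j ^ k * zeta (real p + 1 - real k))" for j
      unfolding E_def distrib_left sum_distrib_left minus_add_distrib sum_negf[symmetric]
    proof (intro arg_cong2[of _ _ _ _ "(+)"] sum.cong)
      fix k assume "k \<in> {1..p-1}"
      then obtain i where "k = Suc i" by (cases k) auto
      then show "- ((-1) ^ j * ((-1) ^ (k - 1) / real j ^ k * zeta (real p + 1 - real k)))
          = (-1) ^ (j + k) / real j ^ k * zeta (real p + 1 - real k)"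
        by (simp add: power_add)
    qed (auto simp: p power_add)
    then have eq: "(-1) ^ j * real (L choose j) * E j = - (real (L choose j) *
              ((-1) ^ (j + p) * harm j / real j ^ p
               + (\<Sum>k=1..p-1. (-1) ^ (j + k) / real j ^ k * zeta (real p + 1 - real k))))" for j
      by (metis mult.assoc mult.commute mult_minus_right minus_minus)
    have "(\<Sum>j=0..L. (-1) ^ j * real (L choose j) * e j)
        = zeta (real p + 1) + (\<Sum>j=1..L. (-1) ^ j * real (L choose j) * E j)"
      by (subst sum.atLeast_Suc_atMost) (auto simp: e_def)
    also have "\<dots> = zeta (real p + 1) - (\<Sum>j=1..L. real (L choose j) *
                 ((-1) ^ (j + p) * harm j / real j ^ p
                  + (\<Sum>k=1..p-1. (-1) ^ (j + k) / real j ^ k * zeta (real p + 1 - real k))))"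
      unfolding eq sum_negf by simp
    finally show "(\<lambda>n. hyperharmonic (int p) q (Suc n)
             / (real (Suc n) * real ((Suc n + l) choose l)))
      sums (zeta (real p + 1)
            - (\<Sum>j=1..L. real (L choose j) *
                 ((-1) ^ (j + p) * harm j / real j ^ p
                  + (\<Sum>k=1..p-1. (-1) ^ (j + k) / real j ^ k
                                  * zeta (real p + 1 - real k)))))"
      using sums by simp
  qed
qed

end
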